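(* Let $I,J$ be positive integers and let $A=(a_{ij})$ and $B=(b_{ij})$ be two $I\times J$ conditional probability matrices, i.e. real matrices with non-negative entries such that $\sum_{i=1}^{I}a_{ij}=1$ for every $j=1,\dots,J$ and $\sum_{j=1}^{J}b_{ij}=1$ for every $i=1,\dots,I$. Let $D$ be the $IJ\times I$ matrix, with rows indexed by pairs $(i,j)$ ($1\le i\le I$, $1\le j\le J$) and columns indexed by $s=1,\dots,I$, whose entries are $$D_{(i,j),s}=a_{ij}b_{sj}-\delta_{is}\,b_{ij},$$ where $\delta_{is}$ is the Kronecker delta. If $\operatorname{rank}(D)\le I-1$, then $A$ and $B$ are compatible. Moreover, equality $\operatorname{rank}(D)=I-1$ holds when there exists a unique solution for the unknown $\eta_1,\dots,\eta_I$, i.e. when there is exactly one probability vector $\underline{\eta}=(\eta_1,\dots,\eta_I)$ (with $\eta_i\ge 0$ and $\sum_{i=1}^{I}\eta_i=1$) satisfying $D\underline{\eta}=0$.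
   Context: Here $A$ plays the role of the conditional distributions of $X$ given $Y$, $a_{ij}=P(X=x_i\mid Y=y_j)$, and $B$ of the conditional distributions of $Y$ given $X$, $b_{ij}=P(Y=y_j\mid X=x_i)$. The matrices $A$ and $B$ are called compatible if there exist stochastic vectors $\underline{\tau}=(\tau_1,\dots,\tau_J)$ and $\underline{\eta}=(\eta_1,\dots,\eta_I)$ (non-negative entries, each vector summing to $1$) such that $a_{ij}\tau_j=b_{ij}\eta_i$ for every $(i,j)$. In that case $p_{ij}=b_{ij}\eta_i=a_{ij}\tau_j$ is a joint probability distribution with marginals $\underline{\eta}$ (of $X$) and $\underline{\tau}$ (of $Y$). The linear system $D\underline{\eta}=0$ is the system of $IJ$ equations $a_{ij}\sum_{s=1}^{I}b_{sj}\eta_s-b_{ij}\eta_i=0$, where $i=1,\dots,I$ and $j=1,\dots,J$; the unknown $\underline{\eta}$ is sought subject to $\eta_i\ge 0$ and $\sum_{i=1}^{I}\eta_i=1$. *)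

theory Defs
  imports "HOL-Analysis.Analysis"
begin

text \<open>
  The index ranges 1..I and 1..J are represented by finite types \<open>'i\<close> and \<open>'j\<close>, so that
  \<open>I = CARD('i)\<close> and \<open>J = CARD('j)\<close> are arbitrary positive integers. The entry in row \<open>i\<close> and
  column \<open>j\<close> of a matrix \<open>A :: real ^ 'j ^ 'i\<close> is \<open>A $ i $ j\<close>.
\<close>

definition stochastic_vector :: "real ^ 'n \<Rightarrow> bool" where
  "stochastic_vector v \<longleftrightarrow> (\<forall>k. v $ k \<ge> 0) \<and> (\<Sum>k\<in>UNIV. v $ k) = 1"

text \<open>Conditional distributions of X given Y (columns sum to 1) and of Y given X (rows sum to 1).\<close>

definition cond_prob_X_given_Y :: "real ^ 'j ^ 'i \<Rightarrow> bool" where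
  "cond_prob_X_given_Y A \<longleftrightarrow> (\<forall>i j. A $ i $ j \<ge> 0) \<and> (\<forall>j. (\<Sum>i\<in>UNIV. A $ i $ j) = 1)"

definition cond_prob_Y_given_X :: "real ^ 'j ^ 'i \<Rightarrow> bool" where
  "cond_prob_Y_given_X B \<longleftrightarrow> (\<forall>i j. B $ i $ j \<ge> 0) \<and> (\<forall>i. (\<Sum>j\<in>UNIV. B $ i $ j) = 1)"

definition compatible :: "real ^ 'j ^ 'i \<Rightarrow> real ^ 'j ^ 'i \<Rightarrow> bool" where
  "compatible A B \<longleftrightarrow>
     (\<exists>(\<tau> :: real ^ 'j) (\<eta> :: real ^ 'i). stochastic_vector \<tau> \<and> stochastic_vector \<eta> \<and>
        (\<forall>i j. A $ i $ j * \<tau> $ j = B $ i $ j * \<eta> $ i))"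

text \<open>
  Rows are indexed by pairs \<open>p = (i, j)\<close>, columns by \<open>s\<close>; \<open>of_bool (i = s)\<close> is the Kronecker delta.
\<close>

definition D_matrix :: "real ^ 'j ^ 'i \<Rightarrow> real ^ 'j ^ 'i \<Rightarrow> real ^ 'i ^ ('i \<times> 'j)" where
  "D_matrix A B =
     (\<chi> p s. case p of (i, j) \<Rightarrow> A $ i $ j * B $ s $ j - of_bool (i = s) * B $ i $ j)"

end

theory Submission
  imports Defs
begin

text \<open>
  Put \<open>\<tau> $ j = (\<Sum>s. B $ s $ j * \<eta> $ s)\<close>. Then \<open>D_matrix A B *v \<eta> = 0\<close> says
  \<open>A $ i $ j * \<tau> $ j = B $ i $ j * \<eta> $ i\<close>, which is the compatibility condition except that
  \<open>\<eta>\<close> need be neither non-negative nor normalized. The signs are harmless because the kernel of \<open>D\<close> is closed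
  under taking entrywise absolute values (lemma \<open>D_kernel_abs\<close>): the moduli of both sides
  agree, and summing over \<open>i\<close>, where the columns of \<open>A\<close> sum to 1, shows that
  \<open>\<bar>\<tau> $ j\<bar>\<close> is the vector that \<open>\<bar>\<eta>\<bar>\<close> gives rise to.

  If the rank of \<open>D\<close> is below the number of columns, the kernel contains some \<open>\<eta> \<noteq> 0\<close>, and
  \<open>\<bar>\<eta>\<bar>\<close> divided by the sum of its entries is a probability vector in the kernel.

  The kernel is closed under linear combinations as well, so it contains the positive and the
  negative part of each of its elements, and is spanned by its non-negative elements. If it
  contains exactly one probability vector, each of these is a multiple of that vector. So the
  kernel is a line (lemma \<open>D_kernel_eq_span\<close>), and rank and nullity add up to the number of columns.
\<close>

text \<open>
  The null space is the orthogonal complement of the row space, whose dimension is the rank.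
\<close>

lemma dim_null_space_plus_rank:
  fixes M :: "real ^ 'n ^ 'm"
  shows "dim {x. M *v x = 0} + rank M = CARD('n)"
proof -
  have "{x. M *v x = 0} = {y. \<forall>r \<in> span (rows M). orthogonal r y}"
  proof (intro equalityI subsetI CollectI ballI)
    fix x r assume "x \<in> {x. M *v x = 0}" "r \<in> span (rows M)"
    then show "orthogonal r x"
      using orthogonal_nullspace_rowspace orthogonal_commute by blast
  next
    fix x assume "x \<in> {y. \<forall>r \<in> span (rows M). orthogonal r y}"
    then have "orthogonal (row k M) x" for k
      by (auto simp: rows_def intro: span_base)
    then show "M *v x = 0"
      by (simp add: vec_eq_iff matrix_vector_mul_component orthogonal_def row_def)
  qed
  then show ?thesis
    using dim_subspace_orthogonal_to_vectors[of "span (rows M)" UNIV]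
    by (simp add: row_rank_def)
qed

lemma D_kernel_iff:
  fixes A B :: "real ^ 'j ^ 'i"
  shows "D_matrix A B *v \<eta> = 0 \<longleftrightarrow>
    (\<forall>i j. A $ i $ j * (\<Sum>s\<in>UNIV. B $ s $ j * \<eta> $ s) = B $ i $ j * \<eta> $ i)"
proof -
  have "(D_matrix A B *v \<eta>) $ (i, j) =
      A $ i $ j * (\<Sum>s\<in>UNIV. B $ s $ j * \<eta> $ s) - B $ i $ j * \<eta> $ i" for i j
    by (simp add: D_matrix_def matrix_vector_mult_def left_diff_distrib sum_subtractf
        sum_distrib_left mult.assoc of_bool_def if_distrib[of "\<lambda>x. x * _"] cong: if_cong)
  then show ?thesis
    by (simp add: vec_eq_iff split_paired_all)
qed

text \<open>
  The products \<open>A $ i $ j * \<tau> $ j\<close> for fixed \<open>j\<close> all have the sign of \<open>\<tau> $ j\<close>. So no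
  cancellation takes place in \<open>\<tau> $ j = (\<Sum>s. B $ s $ j * \<eta> $ s)\<close>, and taking moduli
  preserves the system.
\<close>

lemma D_kernel_abs:
  fixes A B :: "real ^ 'j ^ 'i"
  assumes A: "cond_prob_X_given_Y A" and B: "cond_prob_Y_given_X B"
    and ker: "D_matrix A B *v \<eta> = 0"
  shows "D_matrix A B *v (\<chi> i. \<bar>\<eta> $ i\<bar>) = 0"
proof -
  define t where "t j = (\<Sum>s\<in>UNIV. B $ s $ j * \<eta> $ s)" for j
  have nonneg: "A $ i $ j \<ge> 0" "B $ i $ j \<ge> 0" for i j
    using A B by (auto simp: cond_prob_X_given_Y_def cond_prob_Y_given_X_def)
  have "A $ i $ j * t j = B $ i $ j * \<eta> $ i" for i j
    using ker by (simp add: D_kernel_iff t_def)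
  then have moduli: "A $ i $ j * \<bar>t j\<bar> = B $ i $ j * \<bar>\<eta> $ i\<bar>" for i j
    using nonneg by (metis abs_mult abs_of_nonneg)
  have "(\<Sum>s\<in>UNIV. B $ s $ j * \<bar>\<eta> $ s\<bar>) = (\<Sum>s\<in>UNIV. A $ s $ j) * \<bar>t j\<bar>" for j
    by (simp add: moduli sum_distrib_right)
  then have "(\<Sum>s\<in>UNIV. B $ s $ j * \<bar>\<eta> $ s\<bar>) = \<bar>t j\<bar>" for j
    using A by (simp add: cond_prob_X_given_Y_def)
  then show ?thesis
    by (simp add: D_kernel_iff moduli)
qed

lemma normalize_nonneg_vector:
  fixes v :: "real ^ 'n"
  assumes "\<And>k. v $ k \<ge> 0" and "v \<noteq> 0"
  obtains c where "c > 0" "stochastic_vector (c *\<^sub>R v)"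
proof -
  let ?S = "\<Sum>k\<in>UNIV. v $ k"
  have "?S \<noteq> 0"
    using assms by (simp add: sum_nonneg_eq_0_iff vec_eq_iff)
  then have "?S > 0"
    using assms(1) by (simp add: sum_nonneg less_le)
  then have "stochastic_vector ((1 / ?S) *\<^sub>R v)"
    using assms(1) by (simp add: stochastic_vector_def sum_divide_distrib[symmetric])
  with \<open>?S > 0\<close> show thesis
    by (intro that[of "1 / ?S"]) auto
qed

lemma compatible_if_stochastic_in_D_kernel:
  fixes A B :: "real ^ 'j ^ 'i"
  assumes B: "cond_prob_Y_given_X B"
    and \<eta>: "stochastic_vector \<eta>" and ker: "D_matrix A B *v \<eta> = 0"
  shows "compatible A B"
proof -
  define \<tau> :: "real ^ 'j" where "\<tau> = (\<chi> j. \<Sum>s\<in>UNIV. B $ s $ j * \<eta> $ s)"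
  have "(\<Sum>j\<in>UNIV. \<tau> $ j) = (\<Sum>s\<in>UNIV. (\<Sum>j\<in>UNIV. B $ s $ j) * \<eta> $ s)"
    unfolding \<tau>_def sum_distrib_right by (simp add: sum.swap[of _ UNIV "UNIV :: 'j set"])
  also have "\<dots> = 1"
    using B \<eta> by (simp add: cond_prob_Y_given_X_def stochastic_vector_def)
  finally have "stochastic_vector \<tau>"
    using B \<eta> by (auto simp: stochastic_vector_def \<tau>_def cond_prob_Y_given_X_def intro!: sum_nonneg)
  with \<eta> ker show ?thesis
    unfolding compatible_def D_kernel_iff by (intro exI[of _ \<tau>] exI[of _ \<eta>]) (simp add: \<tau>_def)
qed

lemma compatible_if_rank_D_less:
  fixes A B :: "real ^ 'j ^ 'i"
  assumes A: "cond_prob_X_given_Y A" and B: "cond_prob_Y_given_X B"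
    and "rank (D_matrix A B) < CARD('i)"
  shows "compatible A B"
proof -
  obtain \<eta> where "\<eta> \<noteq> 0" and "D_matrix A B *v \<eta> = 0"
    using assms(3) by (metis less_irrefl matrix_nonfull_linear_equations_eq)
  let ?v = "\<chi> i. \<bar>\<eta> $ i\<bar>"
  have "?v \<noteq> 0"
    using \<open>\<eta> \<noteq> 0\<close> by (simp add: vec_eq_iff)
  then obtain c where "stochastic_vector (c *\<^sub>R ?v)"
    using normalize_nonneg_vector[of ?v] by auto
  moreover have "D_matrix A B *v (c *\<^sub>R ?v) = 0"
    using D_kernel_abs[OF A B \<open>D_matrix A B *v \<eta> = 0\<close>] by (simp add: matrix_vector_mult_scaleR)
  ultimately show ?thesis
    using B compatible_if_stochastic_in_D_kernel by blast
qed

text \<open>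
  An element \<open>u\<close> of the kernel is the difference of \<open>(\<bar>u\<bar> + u) / 2\<close> and \<open>(\<bar>u\<bar> - u) / 2\<close>;
  up to a factor, both are \<open>0\<close> or probability vectors in the kernel, which leaves \<open>\<eta>\<close>
  as the only direction.
\<close>

lemma D_kernel_eq_span:
  fixes A B :: "real ^ 'j ^ 'i"
  assumes A: "cond_prob_X_given_Y A" and B: "cond_prob_Y_given_X B"
    and ker: "D_matrix A B *v \<eta> = 0"
    and unique: "\<And>\<xi>. stochastic_vector \<xi> \<Longrightarrow> D_matrix A B *v \<xi> = 0 \<Longrightarrow> \<xi> = \<eta>"
  shows "{u. D_matrix A B *v u = 0} = span {\<eta>}"
proof
  have nonneg_in_span: "w \<in> span {\<eta>}"
    if w: "D_matrix A B *v w = 0" "\<And>i. w $ i \<ge> 0" for w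
  proof (cases "w = 0")
    case True
    then show ?thesis by (simp add: span_zero)
  next
    case False
    then obtain c where c: "c > 0" "stochastic_vector (c *\<^sub>R w)"
      using normalize_nonneg_vector w(2) by blast
    then have "c *\<^sub>R w = \<eta>"
      using unique w(1) by (simp add: matrix_vector_mult_scaleR)
    then have "w = (1 / c) *\<^sub>R \<eta>"
      using c(1) by auto
    then show ?thesis
      by (simp add: span_base span_scale)
  qed
  show "{u. D_matrix A B *v u = 0} \<subseteq> span {\<eta>}"
  proof
    fix u assume "u \<in> {u. D_matrix A B *v u = 0}"
    then have u: "D_matrix A B *v u = 0" by simp
    define a where "a = (\<chi> i. \<bar>u $ i\<bar>)"
    have a: "D_matrix A B *v a = 0"
      unfolding a_def using A B u by (rule D_kernel_abs)
    have "a + u \<in> span {\<eta>}"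
      using a u by (intro nonneg_in_span) (simp_all add: matrix_vector_right_distrib a_def)
    moreover have "a - u \<in> span {\<eta>}"
      using a u by (intro nonneg_in_span) (simp_all add: matrix_vector_mult_diff_distrib a_def)
    moreover have "u = (1/2) *\<^sub>R ((a + u) - (a - u))"
      by (simp add: vec_eq_iff)
    ultimately show "u \<in> span {\<eta>}"
      by (metis span_diff span_scale)
  qed
  show "span {\<eta>} \<subseteq> {u. D_matrix A B *v u = 0}"
    using ker by (auto simp: span_singleton matrix_vector_mult_scaleR)
qed

theorem theorem2:
  fixes A B :: "real ^ 'j ^ 'i"
  assumes "cond_prob_X_given_Y A"
    and "cond_prob_Y_given_X B"
  shows "(rank (D_matrix A B) \<le> CARD('i) - 1 \<longrightarrow> compatible A B) \<and>
         ((\<exists>!\<eta> :: real ^ 'i. stochastic_vector \<eta> \<and> D_matrix A B *v \<eta> = 0) \<longrightarrow>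
            rank (D_matrix A B) = CARD('i) - 1)"
proof (intro conjI impI)
  assume "rank (D_matrix A B) \<le> CARD('i) - 1"
  moreover have "CARD('i) > 0"
    by simp
  ultimately have "rank (D_matrix A B) < CARD('i)"
    by linarith
  with assms show "compatible A B"
    by (rule compatible_if_rank_D_less)
next
  assume "\<exists>!\<eta> :: real ^ 'i. stochastic_vector \<eta> \<and> D_matrix A B *v \<eta> = 0"
  then obtain \<eta> where \<eta>: "stochastic_vector \<eta>" "D_matrix A B *v \<eta> = 0"
    and "\<And>\<xi>. stochastic_vector \<xi> \<Longrightarrow> D_matrix A B *v \<xi> = 0 \<Longrightarrow> \<xi> = \<eta>"
    by blast
  with assms have "{u. D_matrix A B *v u = 0} = span {\<eta>}"
    by (intro D_kernel_eq_span)
  moreover have "\<eta> \<noteq> 0"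
    using \<eta>(1) by (auto simp: stochastic_vector_def)
  ultimately have "dim {u. D_matrix A B *v u = 0} = 1"
    by simp
  then show "rank (D_matrix A B) = CARD('i) - 1"
    using dim_null_space_plus_rank[of "D_matrix A B"] by simp
qed

end
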